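(* (i) For each $P\in\mathfrak{P}_+(N)$, the map $F^P:\mathfrak{P}_+(N)\to\mathfrak{C}_+(N)$ given componentwise by $$F^P_k(Q)=\frac{1}{2N}\sum_{j=-N+1}^{N}\zeta_j^{k}\,\frac{P(\zeta_j)}{Q(\zeta_j)},\qquad k=0,1,\dots,n,$$ is a homeomorphism. (ii) For each $\mathbf{c}\in\mathfrak{C}_+(N)$, the map $G^{c}:\mathfrak{P}_+(N)\to\mathfrak{Q}_+(N)$ sending $P$ to the unique $Q\in\mathfrak{P}_+(N)$ with $F^P(Q)=\mathbf{c}$ is a homeomorphism, where $$\mathfrak{Q}_+(N)=\{Q\in\mathfrak{P}_+(N): F^P(Q)=\mathbf{c}\ \text{for some } P\in\mathfrak{P}_+(N)\}.$$
   Context: Let $n<N$ be positive integers and $\zeta_j=e^{i\pi j/N}$, $j=-N+1,\dots,N$ (the $2N$-th roots of unity). Let $\mathfrak{P}$ be the finite-dimensional real vector space of symmetric trigonometric polynomials $P(\zeta)=\sum_{k=-n}^{n}p_k\zeta^{-k}$, with $p_k\in\mathbb{C}$, $p_{-k}=\overline{p_k}$ (so $P$ is real-valued on the unit circle). Put $$\mathfrak{P}_+(N)=\{P\in\mathfrak{P}: P(\zeta_j)>0,\ j=-N+1,\dots,N\},$$ and let $\overline{\mathfrak{P}_+(N)}$ be its closure in $\mathfrak{P}$. For $\mathbf{c}=(c_0,c_1,\dots,c_n)$ with $c_0$ real and $c_1,\dots,c_n$ complex, put $c_{-k}=\overline{c_k}$, $C(\zeta)=\sum_{k=-n}^n c_k\zeta^{-k}$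 and, for $P\in\mathfrak{P}$, $\langle C,P\rangle=\sum_{k=-n}^{n}c_k\overline{p_k}$. The (open) dual cone is $$\mathfrak{C}_+(N)=\{\mathbf{c}: \langle C,P\rangle>0\ \text{for all } P\in\overline{\mathfrak{P}_+(N)}\setminus\{0\}\}\subset\mathbb{R}\times\mathbb{C}^n.$$ All these sets carry the topology induced from the finite-dimensional spaces $\mathfrak{P}$ and $\mathbb{R}\times\mathbb{C}^n$. For every $\mathbf{c}\in\mathfrak{C}_+(N)$ and $P\in\mathfrak{P}_+(N)$ there is exactly one $Q\in\mathfrak{P}_+(N)$ with $F^P(Q)=\mathbf{c}$, so $G^c$ is well defined. *)

theory Defs
  imports "HOL-Analysis.Analysis"
begin

text \<open>
  A trigonometric polynomial \<open>\<Sum>k=-n..n. p\<^sub>k \<zeta>\<^sup>-\<^sup>k\<close> is represented by its coefficient family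
  \<open>p :: int \<Rightarrow> complex\<close>, and a vector \<open>(c\<^sub>0,\<dots>,c\<^sub>n)\<close> of \<open>\<real> \<times> \<complex>\<^sup>n\<close> by \<open>c :: nat \<Rightarrow> complex\<close>;
  coefficients outside the index range are zero. The function types carry the product topology,
  which on each of these finite-dimensional subspaces induces the Euclidean topology.
\<close>

definition root_pt :: "nat \<Rightarrow> int \<Rightarrow> complex" where
  "root_pt N j = exp (\<i> * of_real pi * of_int j / of_nat N)"

definition trig_polys :: "nat \<Rightarrow> (int \<Rightarrow> complex) set" where
  "trig_polys n = {p. (\<forall>k. p (- k) = cnj (p k)) \<and> (\<forall>k. \<bar>k\<bar> > int n \<longrightarrow> p k = 0)}"

definition trig_eval :: "nat \<Rightarrow> (int \<Rightarrow> complex) \<Rightarrow> complex \<Rightarrow> complex" where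
  "trig_eval n p z = (\<Sum>k=- int n..int n. p k * z powi (- k))"

lemma trig_eval_real:
  assumes "p \<in> trig_polys n" and "norm z = 1"
  shows "trig_eval n p z \<in> \<real>"
proof -
  have "z * cnj z = 1"
    using assms(2) by (simp add: complex_norm_square [symmetric])
  then have z: "cnj z = inverse z"
    by (simp add: inverse_unique)
  have "cnj (trig_eval n p z) = (\<Sum>k=- int n..int n. p (- k) * z powi k)"
    using assms(1) z by (simp add: trig_eval_def trig_polys_def power_int_minus power_int_inverse)
  also have "\<dots> = trig_eval n p z"
    unfolding trig_eval_def
    by (rule sum.reindex_bij_witness[of _ uminus uminus]) auto
  finally show ?thesis
    by (simp add: Reals_cnj_iff)
qed

text \<open>By \<open>trig_eval_real\<close>, the values at the nodes are real, so the real part is the value.\<close>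

definition pos_polys :: "nat \<Rightarrow> nat \<Rightarrow> (int \<Rightarrow> complex) set" where
  "pos_polys n N = {p \<in> trig_polys n. \<forall>j\<in>{- int N + 1..int N}. 0 < Re (trig_eval n p (root_pt N j))}"

definition moment_space :: "nat \<Rightarrow> (nat \<Rightarrow> complex) set" where
  "moment_space n = {c. c 0 \<in> \<real> \<and> (\<forall>k>n. c k = 0)}"

definition herm_ext :: "(nat \<Rightarrow> complex) \<Rightarrow> int \<Rightarrow> complex" where
  "herm_ext c k = (if 0 \<le> k then c (nat k) else cnj (c (nat (- k))))"

definition pairing :: "nat \<Rightarrow> (nat \<Rightarrow> complex) \<Rightarrow> (int \<Rightarrow> complex) \<Rightarrow> complex" where
  "pairing n c p = (\<Sum>k=- int n..int n. herm_ext c k * cnj (p k))"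

lemma pairing_real:
  assumes "c \<in> moment_space n" and "p \<in> trig_polys n"
  shows "pairing n c p \<in> \<real>"
proof -
  have c: "herm_ext c (- k) = cnj (herm_ext c k)" for k
    using assms(1) by (cases "k = 0") (auto simp: herm_ext_def moment_space_def Reals_cnj_iff)
  have p: "p (- k) = cnj (p k)" for k
    using assms(2) by (simp add: trig_polys_def)
  have "cnj (pairing n c p) = (\<Sum>k=- int n..int n. herm_ext c (- k) * cnj (p (- k)))"
    by (simp add: pairing_def c p)
  also have "\<dots> = pairing n c p"
    unfolding pairing_def
    by (rule sum.reindex_bij_witness[of _ uminus uminus]) auto
  finally show ?thesis
    by (simp add: Reals_cnj_iff)
qed

text \<open>
  The intersection with \<^term>\<open>trig_polys n\<close> is the closure relative to that space.
  By \<open>pairing_real\<close>, the pairing is real, so its real part is its value.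
\<close>

definition dual_cone :: "nat \<Rightarrow> nat \<Rightarrow> (nat \<Rightarrow> complex) set" where
  "dual_cone n N = {c \<in> moment_space n.
     \<forall>p \<in> (trig_polys n \<inter> closure (pos_polys n N)) - {\<lambda>_. 0}. 0 < Re (pairing n c p)}"

definition moment_map ::
    "nat \<Rightarrow> nat \<Rightarrow> (int \<Rightarrow> complex) \<Rightarrow> (int \<Rightarrow> complex) \<Rightarrow> nat \<Rightarrow> complex" where
  "moment_map n N p q k =
     (if k \<le> n
      then 1 / (2 * of_nat N) * (\<Sum>j=- int N + 1..int N.
             root_pt N j ^ k * (trig_eval n p (root_pt N j) / trig_eval n q (root_pt N j)))
      else 0)"

definition solution_map ::
    "nat \<Rightarrow> nat \<Rightarrow> (nat \<Rightarrow> complex) \<Rightarrow> (int \<Rightarrow> complex) \<Rightarrow> int \<Rightarrow> complex" where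
  "solution_map n N c p = (THE q. q \<in> pos_polys n N \<and> moment_map n N p q = c)"

definition solution_set :: "nat \<Rightarrow> nat \<Rightarrow> (nat \<Rightarrow> complex) \<Rightarrow> (int \<Rightarrow> complex) set" where
  "solution_set n N c = {q \<in> pos_polys n N. \<exists>p \<in> pos_polys n N. moment_map n N p q = c}"

end

theory Submission
  imports Defs
begin

text \<open>
  Everything is read off at the nodes. A trigonometric polynomial of degree \<open>n < N\<close> is determined by
  its \<open>2 * N\<close> real node values, with the coefficients given by the inverse discrete Fourier transform, and
  by Parseval the pairing of \<open>c\<close> with \<open>r\<close> is the mean over the nodes of \<open>c\<^sub>j * r\<^sub>j\<close>, where \<open>c\<^sub>j\<close> are
  the node values of the polynomial \<open>C\<close> with coefficients \<open>c\<close>. The equation \<open>F\<^sup>P(Q) = c\<close> thus takes the weak form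
  (\<open>moment_map_eq_iff\<close>)
    \<open>\<Sum>j. c\<^sub>j * r\<^sub>j = \<Sum>j. P\<^sub>j / Q\<^sub>j * r\<^sub>j\<close>  for all trigonometric polynomials \<open>r\<close>.

  Existence of \<open>Q\<close> for given \<open>P\<close> and \<open>c\<close> (\<open>moment_map_surj\<close>) is variational. The functional
  \<open>\<Sum>j. c\<^sub>j * Q\<^sub>j - P\<^sub>j * ln Q\<^sub>j\<close> has the weak form as its stationarity condition. As \<open>c\<close> lies in the
  open dual cone, compactness gives \<open>\<Sum>j. c\<^sub>j * Q\<^sub>j \<ge> e * (\<Sum>j. Q\<^sub>j)\<close> with some \<open>e > 0\<close>
  (\<open>dual_cone_coercive\<close>), and so the functional dominates a sum of terms \<open>e * Q\<^sub>j - P\<^sub>j * ln Q\<^sub>j\<close>, each of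
  which tends to infinity at \<open>0\<close> and at infinity. Its sublevel sets are therefore
  compact inside the open cone, and a minimiser exists.

  Uniqueness and continuity come together from monotonicity of \<open>t \<mapsto> 1 / t\<close>: testing the difference of
  two moment equations with the difference of their solutions gives a sum of squares, which is small when
  the data are close. This works for \<open>Q\<close> as a function of the pair \<open>(P, c)\<close>, which settles
  the continuity of both the inverse of \<open>F\<^sup>P\<close> and of \<open>G\<^sup>c\<close> (\<open>tendsto_denominator\<close>), and
  for \<open>P\<close> as a function of \<open>Q\<close> when \<open>c\<close> is fixed, which settles the inverse of \<open>G\<^sup>c\<close>
  (\<open>tendsto_numerator\<close>). Injectivity is the case of constant families.
\<close>

section \<open>Stability of weighted quotients under perturbation\<close>

text \<open>
  Testing the relation of the limit with \<open>q'\<close> bounds \<open>q'\<close> from above, because \<open>c'\<close> differs from \<open>c\<close> by less than half of the positive weights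
  \<open>p / q\<close>. Testing the difference of both relations with \<open>q' - q\<close> then bounds
  \<open>\<Sum>j. p'\<^sub>j * (q'\<^sub>j - q\<^sub>j)\<^sup>2 / (q'\<^sub>j * q\<^sub>j)\<close> by the size of the perturbation times bounded quantities.
\<close>

lemma tendsto_denominator_of_moment_relations:
  fixes p q c :: "'i \<Rightarrow> real" and p' q' c' :: "'x \<Rightarrow> 'i \<Rightarrow> real"
  assumes J: "finite J" and i: "i \<in> J"
    and pos: "\<And>j. j \<in> J \<Longrightarrow> 0 < p j" "\<And>j. j \<in> J \<Longrightarrow> 0 < q j"
    and pos': "\<forall>\<^sub>F x in F. \<forall>j\<in>J. 0 < p' x j \<and> 0 < q' x j"
    and p': "\<And>j. j \<in> J \<Longrightarrow> ((\<lambda>x. p' x j) \<longlongrightarrow> p j) F"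
    and c': "\<And>j. j \<in> J \<Longrightarrow> ((\<lambda>x. c' x j) \<longlongrightarrow> c j) F"
    and eq: "\<forall>\<^sub>F x in F. \<forall>r\<in>{q, q' x}. (\<Sum>j\<in>J. c j * r j) = (\<Sum>j\<in>J. p j / q j * r j) \<and>
               (\<Sum>j\<in>J. c' x j * r j) = (\<Sum>j\<in>J. p' x j / q' x j * r j)"
  shows "((\<lambda>x. q' x i) \<longlongrightarrow> q i) F"
proof -
  \<comment> \<open>\<open>B\<close> is an eventual upper bound for \<open>q'\<close>; \<open>E\<close> bounds the weighted square distance of \<open>q'\<close> and \<open>q\<close>.\<close>
  define B where "B j = 2 * ((\<Sum>j\<in>J. p j) + 1) * q j / p j" for j
  define E where "E x = (\<Sum>j\<in>J. (\<bar>p' x j - p j\<bar> / q j + \<bar>c' x j - c j\<bar>) * (B j + q j))" for x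
  have E0: "(E \<longlongrightarrow> 0) F"
  proof -
    have "((\<lambda>x. \<Sum>j\<in>J. (\<bar>p' x j - p j\<bar> / q j + \<bar>c' x j - c j\<bar>) * (B j + q j)) \<longlongrightarrow>
            (\<Sum>j\<in>J. (\<bar>p j - p j\<bar> / q j + \<bar>c j - c j\<bar>) * (B j + q j))) F"
      by (intro tendsto_intros p' c') (use pos(2) in force)+
    then show ?thesis by (simp add: E_def[abs_def])
  qed
  have "((\<lambda>x. \<Sum>j\<in>J. p' x j) \<longlongrightarrow> (\<Sum>j\<in>J. p j)) F"
    by (intro tendsto_intros p')
  then have ev1: "\<forall>\<^sub>F x in F. (\<Sum>j\<in>J. p' x j) < (\<Sum>j\<in>J. p j) + 1"
    by (rule order_tendstoD) simp
  have ev2: "\<forall>\<^sub>F x in F. \<forall>j\<in>J. \<bar>c' x j - c j\<bar> < p j / (2 * q j)"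
  proof (intro eventually_ball_finite J ballI)
    fix j assume j: "j \<in> J"
    have "0 < p j / (2 * q j)" using pos j by simp
    from tendstoD[OF c'[OF j] this] show "\<forall>\<^sub>F x in F. \<bar>c' x j - c j\<bar> < p j / (2 * q j)"
      by (simp add: dist_real_def)
  qed
  have est: "\<forall>\<^sub>F x in F. (q' x i - q i)\<^sup>2 \<le> B i * q i * E x / p' x i"
    using pos' eq ev1 ev2
  proof eventually_elim
    case (elim x)
    have P: "0 < p' x j" "0 < q' x j" if "j \<in> J" for j using elim(1) that by auto
    have bound: "q' x k \<le> B k" if k: "k \<in> J" for k
    proof -
      have "p k / (2 * q k) * q' x k \<le> (\<Sum>j\<in>J. p j / (2 * q j) * q' x j)"
        using J k pos P by (intro member_le_sum mult_nonneg_nonneg divide_nonneg_nonneg) (auto simp: less_imp_le)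
      also have "\<dots> = (\<Sum>j\<in>J. c j * q' x j) - (\<Sum>j\<in>J. p j / (2 * q j) * q' x j)"
        using elim(2) by (simp add: sum_subtractf[symmetric])
      also have "\<dots> = (\<Sum>j\<in>J. (c j - p j / (2 * q j)) * q' x j)"
        by (simp add: sum_subtractf left_diff_distrib)
      also have "\<dots> \<le> (\<Sum>j\<in>J. c' x j * q' x j)"
        using elim(4) P by (intro sum_mono mult_right_mono) (force simp: less_imp_le)+
      also have "\<dots> = (\<Sum>j\<in>J. p' x j)"
        using elim(2) P by (auto intro!: sum.cong simp: less_imp_neq[symmetric])
      also have "\<dots> \<le> (\<Sum>j\<in>J. p j) + 1" using elim(3) by simp
      finally show ?thesis using pos[OF k] by (simp add: B_def field_simps)
    qed
    have "p' x i * (q' x i - q i)\<^sup>2 / (q' x i * q i) \<le> (\<Sum>j\<in>J. p' x j * (q' x j - q j)\<^sup>2 / (q' x j * q j))"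
      using J i pos P by (intro member_le_sum mult_nonneg_nonneg divide_nonneg_nonneg) (auto simp: less_imp_le)
    also have "\<dots> = (\<Sum>j\<in>J. (p' x j - p j) / q j * (q' x j - q j)
        - (p' x j / q' x j - p j / q j) * (q' x j - q j))"
    proof (intro sum.cong refl)
      fix j assume "j \<in> J"
      then have "q j \<noteq> 0" "q' x j \<noteq> 0" using pos(2) P(2) by force+
      then show "p' x j * (q' x j - q j)\<^sup>2 / (q' x j * q j) = (p' x j - p j) / q j * (q' x j - q j)
        - (p' x j / q' x j - p j / q j) * (q' x j - q j)"
        by (simp add: field_simps power2_eq_square)
    qed
    also have "\<dots> = (\<Sum>j\<in>J. ((p' x j - p j) / q j - (c' x j - c j)) * (q' x j - q j))"
    proof -
      have "(\<Sum>j\<in>J. (p' x j / q' x j - p j / q j) * (q' x j - q j)) = (\<Sum>j\<in>J. (c' x j - c j) * (q' x j - q j))"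
        using elim(2) by (simp add: left_diff_distrib right_diff_distrib sum_subtractf)
      then show ?thesis by (simp add: left_diff_distrib sum_subtractf)
    qed
    also have "\<dots> \<le> E x"
      unfolding E_def
    proof (intro sum_mono)
      fix j assume j: "j \<in> J"
      have "((p' x j - p j) / q j - (c' x j - c j)) * (q' x j - q j)
          \<le> \<bar>(p' x j - p j) / q j - (c' x j - c j)\<bar> * \<bar>q' x j - q j\<bar>"
        by (metis abs_ge_self abs_mult)
      also have "\<dots> \<le> (\<bar>p' x j - p j\<bar> / q j + \<bar>c' x j - c j\<bar>) * (B j + q j)"
      proof (intro mult_mono)
        have "\<bar>(p' x j - p j) / q j\<bar> = \<bar>p' x j - p j\<bar> / q j" using pos(2)[OF j] by simp
        then show "\<bar>(p' x j - p j) / q j - (c' x j - c j)\<bar> \<le> \<bar>p' x j - p j\<bar> / q j + \<bar>c' x j - c j\<bar>"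
          by linarith
      qed (use bound[OF j] P[OF j] pos[OF j] in auto)
      finally show "((p' x j - p j) / q j - (c' x j - c j)) * (q' x j - q j)
          \<le> (\<bar>p' x j - p j\<bar> / q j + \<bar>c' x j - c j\<bar>) * (B j + q j)" .
    qed
    finally have *: "p' x i * (q' x i - q i)\<^sup>2 / (q' x i * q i) \<le> E x" .
    have E: "0 \<le> E x"
      by (rule order_trans[OF _ *]) (use P[OF i] pos[OF i] in simp)
    have "(q' x i - q i)\<^sup>2 \<le> q' x i * (q i * E x / p' x i)"
      using * P[OF i] pos[OF i] by (simp add: field_simps)
    also have "\<dots> \<le> B i * (q i * E x / p' x i)"
      using bound[OF i] P[OF i] pos[OF i] E by (intro mult_right_mono) auto
    finally show ?case by simp
  qed
  have "((\<lambda>x. B i * q i * E x / p' x i) \<longlongrightarrow> B i * q i * 0 / p i) F"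
    by (intro tendsto_intros E0 p' i) (use pos(1) i in force)
  then have "((\<lambda>x. (q' x i - q i)\<^sup>2) \<longlongrightarrow> 0) F"
    by (intro tendsto_sandwich[OF _ est tendsto_const]) auto
  then have "((\<lambda>x. q' x i - q i) \<longlongrightarrow> 0) F"
    by simp
  then show ?thesis by (simp add: LIM_zero_iff)
qed

text \<open>
  With \<open>a = p / q' - p / q\<close>, which tends to \<open>0\<close>, the relation says that
  \<open>\<Sum>j. (p'\<^sub>j - p\<^sub>j)\<^sup>2 / q'\<^sub>j = - (\<Sum>j. a\<^sub>j * (p'\<^sub>j - p\<^sub>j))\<close>. The right-hand side is linear in
  \<open>p' - p\<close>, and the arithmetic-geometric mean inequality absorbs it into the left-hand side without any a priori bound
  on \<open>p'\<close>.
\<close>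

lemma tendsto_numerator_of_moment_relations:
  fixes p q :: "'i \<Rightarrow> real" and p' q' :: "'x \<Rightarrow> 'i \<Rightarrow> real"
  assumes J: "finite J" and i: "i \<in> J"
    and pos: "\<And>j. j \<in> J \<Longrightarrow> 0 < q j"
    and pos': "\<forall>\<^sub>F x in F. \<forall>j\<in>J. 0 < q' x j"
    and q': "\<And>j. j \<in> J \<Longrightarrow> ((\<lambda>x. q' x j) \<longlongrightarrow> q j) F"
    and eq: "\<forall>\<^sub>F x in F. (\<Sum>j\<in>J. p' x j / q' x j * (p' x j - p j)) = (\<Sum>j\<in>J. p j / q j * (p' x j - p j))"
  shows "((\<lambda>x. p' x i) \<longlongrightarrow> p i) F"
proof -
  define a where "a x j = p j / q' x j - p j / q j" for x j
  have a: "((\<lambda>x. a x j) \<longlongrightarrow> 0) F" if j: "j \<in> J" for j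
  proof -
    have "((\<lambda>x. a x j) \<longlongrightarrow> p j / q j - p j / q j) F"
      unfolding a_def by (intro tendsto_intros q' j) (use pos j in force)+
    then show ?thesis by simp
  qed
  have est: "\<forall>\<^sub>F x in F. (p' x i - p i)\<^sup>2 \<le> q' x i * (\<Sum>j\<in>J. q' x j * (a x j)\<^sup>2)"
    using pos' eq
  proof eventually_elim
    case (elim x)
    have P: "0 < q' x j" if "j \<in> J" for j using elim(1) that by auto
    have "(\<Sum>j\<in>J. (p' x j - p j)\<^sup>2 / q' x j) = (\<Sum>j\<in>J. (p' x j / q' x j * (p' x j - p j) - p j / q j * (p' x j - p j)) - a x j * (p' x j - p j))"
      by (intro sum.cong refl) (simp add: a_def algebra_simps power2_eq_square add_divide_distrib diff_divide_distrib)
    also have "\<dots> = - (\<Sum>j\<in>J. a x j * (p' x j - p j))"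
      using elim(2) by (simp add: sum_subtractf)
    also have "\<dots> \<le> (\<Sum>j\<in>J. (p' x j - p j)\<^sup>2 / q' x j / 2 + q' x j * (a x j)\<^sup>2 / 2)"
      unfolding sum_negf[symmetric]
    proof (intro sum_mono)
      fix j assume "j \<in> J"
      define y where "y = p' x j - p j"
      have Q: "0 < q' x j" by (rule P) fact
      have "0 \<le> (y + q' x j * a x j)\<^sup>2 / (2 * q' x j)" using Q by simp
      also have "\<dots> = y\<^sup>2 / q' x j / 2 + q' x j * (a x j)\<^sup>2 / 2 + a x j * y"
        using Q by (simp add: field_simps power2_eq_square)
      finally show "- (a x j * (p' x j - p j)) \<le> (p' x j - p j)\<^sup>2 / q' x j / 2 + q' x j * (a x j)\<^sup>2 / 2"
        by (simp add: y_def)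
    qed
    also have "\<dots> = (\<Sum>j\<in>J. (p' x j - p j)\<^sup>2 / q' x j) / 2 + (\<Sum>j\<in>J. q' x j * (a x j)\<^sup>2) / 2"
      by (simp add: sum.distrib sum_divide_distrib)
    finally have "(\<Sum>j\<in>J. (p' x j - p j)\<^sup>2 / q' x j) \<le> (\<Sum>j\<in>J. q' x j * (a x j)\<^sup>2)"
      by simp
    moreover have "(p' x i - p i)\<^sup>2 / q' x i \<le> (\<Sum>j\<in>J. (p' x j - p j)\<^sup>2 / q' x j)"
      using J i P by (intro member_le_sum) (auto simp: less_imp_le)
    ultimately have "(p' x i - p i)\<^sup>2 / q' x i \<le> (\<Sum>j\<in>J. q' x j * (a x j)\<^sup>2)"
      by linarith
    then show ?case using P[OF i] by (simp add: field_simps)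
  qed
  have "((\<lambda>x. q' x i * (\<Sum>j\<in>J. q' x j * (a x j)\<^sup>2)) \<longlongrightarrow> q i * (\<Sum>j\<in>J. q j * 0\<^sup>2)) F"
    by (intro tendsto_intros q' i a)
  then have "((\<lambda>x. (p' x i - p i)\<^sup>2) \<longlongrightarrow> 0) F"
    by (intro tendsto_sandwich[OF _ est tendsto_const]) auto
  then have "((\<lambda>x. p' x i - p i) \<longlongrightarrow> 0) F"
    by simp
  then show ?thesis by (simp add: LIM_zero_iff)
qed

section \<open>Fourier analysis on the roots of unity\<close>

abbreviation nodes :: "nat \<Rightarrow> int set" where
  "nodes N \<equiv> {- int N + 1..int N}"

lemma norm_root_pt [simp]: "norm (root_pt N j) = 1"
  by (simp add: root_pt_def)

lemma root_pt_nonzero [simp]: "root_pt N j \<noteq> 0"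
  by (simp add: root_pt_def)

lemma cnj_root_pt_powi: "cnj (root_pt N j powi k) = root_pt N j powi (- k)"
proof -
  have "root_pt N j * cnj (root_pt N j) = 1"
    by (simp add: complex_norm_square [symmetric])
  then have "cnj (root_pt N j) = inverse (root_pt N j)"
    by (simp add: inverse_unique)
  then show ?thesis
    by (simp add: power_int_minus power_int_inverse)
qed

text \<open>
  For \<open>m \<noteq> 0\<close>, multiplication by the ratio \<open>z\<close> of the geometric sum shifts the index by one, and this leaves the sum over a full
  period unchanged; as \<open>z \<noteq> 1\<close>, the sum is \<open>0\<close>.
\<close>

lemma sum_root_pt_powi:
  assumes "\<bar>m\<bar> < 2 * int N"
  shows "(\<Sum>j\<in>nodes N. root_pt N j powi m) = (if m = 0 then 2 * of_nat N else 0)"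
proof (cases "m = 0")
  case True
  then show ?thesis by simp
next
  case m: False
  have N: "0 < N" using assms by (cases N) auto
  define z where "z = exp (\<i> * of_real pi * of_int m / of_nat N)"
  have z0: "z \<noteq> 0" by (simp add: z_def)
  have z: "root_pt N j powi m = z powi j" for j
    by (simp add: root_pt_def z_def exp_power_int mult_ac)
  have "z powi (2 * int N) = exp (2 * of_int m * of_real pi * \<i>)"
    using N by (simp add: z_def exp_power_int field_simps)
  also have "\<dots> = 1"
    by (subst exp_eq_1) (auto intro!: exI[of _ m])
  finally have per: "z powi (int N + 1) = z powi (- int N + 1)"
    using z0 power_int_add[of z "- int N + 1" "2 * int N"] by simp
  have z1: "z \<noteq> 1"
  proof
    assume "z = 1"
    then obtain l :: int where "pi * of_int m / of_nat N = of_int (2 * l) * pi"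
      unfolding z_def exp_eq_1 by auto
    then have "real_of_int m = real_of_int (2 * l * int N)"
      using N by (simp add: field_simps)
    then have "m = 2 * int N * l" by (simp only: of_int_eq_iff) simp
    with assms m show False
      by (metis abs_mult abs_of_nat abs_numeral dvd_imp_le_int dvd_triv_left linorder_not_le)
  qed
  let ?S = "\<Sum>j\<in>nodes N. z powi j"
  have "z * ?S = (\<Sum>j\<in>nodes N. z powi (j + 1))"
    using z0 by (simp add: sum_distrib_left power_int_add mult.commute)
  also have "\<dots> = (\<Sum>j=- int N + 2..int N + 1. z powi j)"
    by (rule sum.reindex_bij_witness[of _ "\<lambda>j. j - 1" "\<lambda>j. j + 1"]) auto
  also have "\<dots> = ?S"
  proof -
    have "nodes N = insert (- int N + 1) {- int N + 2..int N}"
         "{- int N + 2..int N + 1} = insert (int N + 1) {- int N + 2..int N}"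
      using N by auto
    then show ?thesis by (simp add: per)
  qed
  finally have "(z - 1) * ?S = 0" by (simp add: left_diff_distrib)
  with z1 m show ?thesis by (simp add: z)
qed

definition node_val :: "nat \<Rightarrow> nat \<Rightarrow> (int \<Rightarrow> complex) \<Rightarrow> int \<Rightarrow> real" where
  "node_val n N p j = Re (trig_eval n p (root_pt N j))"

lemma of_real_node_val:
  "p \<in> trig_polys n \<Longrightarrow> complex_of_real (node_val n N p j) = trig_eval n p (root_pt N j)"
  using trig_eval_real[of p n "root_pt N j"] by (simp add: node_val_def)

lemma node_val_add_scaled:
  "node_val n N (\<lambda>k. p k + of_real t * r k) j = node_val n N p j + t * node_val n N r j"
  by (simp add: node_val_def trig_eval_def distrib_right sum.distrib mult.assoc flip: sum_distrib_left)

lemma trig_polys_add_scaled: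
  "p \<in> trig_polys n \<Longrightarrow> r \<in> trig_polys n \<Longrightarrow> (\<lambda>k. p k + of_real t * r k) \<in> trig_polys n"
  by (simp add: trig_polys_def)

text \<open>
  Fourier inversion. The frequencies \<open>k - l\<close> that occur are at most \<open>2 * n\<close> in modulus, so \<open>n < N\<close>
  excludes aliasing modulo \<open>2 * N\<close>.
\<close>

lemma coeff_eq_sum_node_val:
  assumes p: "p \<in> trig_polys n" and k: "\<bar>k\<bar> \<le> int n" and nN: "n < N"
  shows "2 * of_nat N * p k = (\<Sum>j\<in>nodes N. root_pt N j powi k * of_real (node_val n N p j))"
proof -
  have "(\<Sum>j\<in>nodes N. root_pt N j powi k * of_real (node_val n N p j))
      = (\<Sum>j\<in>nodes N. \<Sum>l=- int n..int n. p l * root_pt N j powi (k - l))"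
    by (simp add: of_real_node_val[OF p] trig_eval_def sum_distrib_left power_int_diff
        power_int_minus divide_inverse mult_ac)
  also have "\<dots> = (\<Sum>l=- int n..int n. p l * (\<Sum>j\<in>nodes N. root_pt N j powi (k - l)))"
    by (subst sum.swap) (simp add: sum_distrib_left)
  also have "\<dots> = (\<Sum>l=- int n..int n. if l = k then 2 * of_nat N * p k else 0)"
    using k nN by (intro sum.cong refl) (subst sum_root_pt_powi, auto)
  also have "\<dots> = 2 * of_nat N * p k"
    using k by (simp add: abs_le_iff)
  finally show ?thesis by simp
qed

lemma trig_poly_eqI:
  assumes "p \<in> trig_polys n" "r \<in> trig_polys n" "n < N"
    and "\<And>j. j \<in> nodes N \<Longrightarrow> node_val n N p j = node_val n N r j"
  shows "p = r"
proof
  fix k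
  show "p k = r k"
  proof (cases "\<bar>k\<bar> \<le> int n")
    case True
    have "2 * of_nat N * p k = 2 * of_nat N * r k"
      unfolding coeff_eq_sum_node_val[OF assms(1) True assms(3)]
        coeff_eq_sum_node_val[OF assms(2) True assms(3)]
      by (simp add: assms(4))
    with assms(3) show ?thesis by simp
  qed (use assms in \<open>simp add: trig_polys_def\<close>)
qed

lemma herm_ext_in_trig_polys:
  "c \<in> moment_space n \<Longrightarrow> herm_ext c \<in> trig_polys n"
  by (auto simp: herm_ext_def moment_space_def trig_polys_def Reals_cnj_iff)

text \<open>
  The weights \<open>w\<close> are arbitrary: only their low Fourier coefficients have to agree with \<open>c\<close>. Both the node
  values of the polynomial with coefficients \<open>c\<close> and the quotients \<open>P\<^sub>j / Q\<^sub>j\<close> are of this kind.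
\<close>

lemma pairing_weighted_sum:
  fixes w :: "int \<Rightarrow> real"
  assumes r: "r \<in> trig_polys n"
    and c: "\<And>k. \<bar>k\<bar> \<le> int n \<Longrightarrow>
      2 * of_nat N * herm_ext c k = (\<Sum>j\<in>nodes N. root_pt N j powi k * of_real (w j))"
  shows "2 * real N * Re (pairing n c r) = (\<Sum>j\<in>nodes N. w j * node_val n N r j)"
proof -
  have "2 * of_nat N * pairing n c r
      = (\<Sum>k=- int n..int n. \<Sum>j\<in>nodes N. root_pt N j powi k * of_real (w j) * cnj (r k))"
    unfolding pairing_def sum_distrib_left
    by (intro sum.cong refl) (simp add: c sum_distrib_right abs_le_iff flip: mult.assoc)
  also have "\<dots> = (\<Sum>j\<in>nodes N. of_real (w j) * cnj (trig_eval n r (root_pt N j)))"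
    unfolding trig_eval_def cnj_sum complex_cnj_mult cnj_root_pt_powi
    by (subst sum.swap) (simp add: sum_distrib_left mult_ac)
  also have "\<dots> = of_real (\<Sum>j\<in>nodes N. w j * node_val n N r j)"
    by (simp flip: of_real_node_val[OF r])
  finally have "Re (2 * of_nat N * pairing n c r) = (\<Sum>j\<in>nodes N. w j * node_val n N r j)"
    by simp
  then show ?thesis by simp
qed

lemma pairing_eq_sum_node_val:
  assumes c: "c \<in> moment_space n" and r: "r \<in> trig_polys n" and nN: "n < N"
  shows "2 * real N * Re (pairing n c r)
    = (\<Sum>j\<in>nodes N. node_val n N (herm_ext c) j * node_val n N r j)"
  by (rule pairing_weighted_sum[OF r coeff_eq_sum_node_val[OF herm_ext_in_trig_polys[OF c] _ nN]])

lemma herm_ext_moment_map: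
  assumes p: "p \<in> trig_polys n" and q: "q \<in> trig_polys n" and k: "\<bar>k\<bar> \<le> int n" and N: "0 < N"
  shows "2 * of_nat N * herm_ext (moment_map n N p q) k
    = (\<Sum>j\<in>nodes N. root_pt N j powi k * of_real (node_val n N p j / node_val n N q j))"
proof -
  have m: "2 * of_nat N * moment_map n N p q l
      = (\<Sum>j\<in>nodes N. root_pt N j powi int l * of_real (node_val n N p j / node_val n N q j))"
    if "l \<le> n" for l
    using that N by (simp add: moment_map_def of_real_node_val[OF p] of_real_node_val[OF q])
  show ?thesis
  proof (cases "0 \<le> k")
    case True
    then show ?thesis using m[of "nat k"] k by (simp add: herm_ext_def)
  next
    case False
    then have "2 * of_nat N * herm_ext (moment_map n N p q) k
        = cnj (2 * of_nat N * moment_map n N p q (nat (- k)))"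
      by (simp add: herm_ext_def)
    also have "\<dots> = (\<Sum>j\<in>nodes N. root_pt N j powi k * of_real (node_val n N p j / node_val n N q j))"
      using False k by (subst m) (simp_all add: cnj_root_pt_powi del: complex_cnj_power_int)
    finally show ?thesis .
  qed
qed

lemma moment_map_in_moment_space:
  assumes p: "p \<in> trig_polys n" and q: "q \<in> trig_polys n"
  shows "moment_map n N p q \<in> moment_space n"
proof -
  have "moment_map n N p q 0
      = of_real (1 / (2 * real N) * (\<Sum>j\<in>nodes N. node_val n N p j / node_val n N q j))"
    by (simp add: moment_map_def of_real_node_val[OF p] of_real_node_val[OF q])
  then show ?thesis
    by (simp add: moment_space_def del: of_real_mult) (simp add: moment_map_def)
qed

text \<open>
  The weak form of the moment equation. It determines \<open>c\<close> because the difference of two candidates is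
  itself an admissible test polynomial, and is then orthogonal to itself.
\<close>

lemma moment_map_eq_iff:
  assumes c: "c \<in> moment_space n" and p: "p \<in> trig_polys n" and q: "q \<in> trig_polys n" and nN: "n < N"
  shows "moment_map n N p q = c \<longleftrightarrow> (\<forall>r\<in>trig_polys n.
    (\<Sum>j\<in>nodes N. node_val n N (herm_ext c) j * node_val n N r j)
    = (\<Sum>j\<in>nodes N. node_val n N p j / node_val n N q j * node_val n N r j))"
proof -
  have N: "0 < N" using nN by simp
  define m where "m = moment_map n N p q"
  have m: "m \<in> moment_space n" unfolding m_def by (rule moment_map_in_moment_space[OF p q])
  have weak: "(\<Sum>j\<in>nodes N. node_val n N (herm_ext m) j * node_val n N r j)
    = (\<Sum>j\<in>nodes N. node_val n N p j / node_val n N q j * node_val n N r j)"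
    if r: "r \<in> trig_polys n" for r
    unfolding pairing_eq_sum_node_val[OF m r nN, symmetric]
    unfolding m_def
    by (rule pairing_weighted_sum[OF r herm_ext_moment_map[OF p q _ N]])
  have "m = c" if eq: "\<And>r. r \<in> trig_polys n \<Longrightarrow>
    (\<Sum>j\<in>nodes N. node_val n N (herm_ext c) j * node_val n N r j)
    = (\<Sum>j\<in>nodes N. node_val n N (herm_ext m) j * node_val n N r j)"
  proof -
    note T = herm_ext_in_trig_polys[OF c] herm_ext_in_trig_polys[OF m]
    define d where "d = (\<lambda>k. herm_ext c k + of_real (- 1) * herm_ext m k)"
    have d: "d \<in> trig_polys n" unfolding d_def by (intro trig_polys_add_scaled T)
    have dv: "node_val n N d j = node_val n N (herm_ext c) j - node_val n N (herm_ext m) j" for j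
      unfolding d_def node_val_add_scaled by simp
    have "(\<Sum>j\<in>nodes N. (node_val n N d j)\<^sup>2)
      = (\<Sum>j\<in>nodes N. node_val n N (herm_ext c) j * node_val n N d j)
      - (\<Sum>j\<in>nodes N. node_val n N (herm_ext m) j * node_val n N d j)"
      by (simp add: dv power2_eq_square left_diff_distrib flip: sum_subtractf)
    then have "(\<Sum>j\<in>nodes N. (node_val n N d j)\<^sup>2) = 0"
      using eq[OF d] by simp
    then have "\<forall>j\<in>nodes N. node_val n N d j = 0"
      by (subst (asm) sum_nonneg_eq_0_iff) auto
    then have "herm_ext c = herm_ext m"
      by (intro trig_poly_eqI[OF T nN]) (simp add: dv)
    then have "herm_ext c (int k) = herm_ext m (int k)" for k by simp
    then show "m = c" by (simp add: herm_ext_def fun_eq_iff)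
  qed
  then show ?thesis using weak by (auto simp: m_def[symmetric])
qed

section \<open>Topology of the positive cone and its dual\<close>

definition const_poly :: "real \<Rightarrow> int \<Rightarrow> complex" where
  "const_poly t k = (if k = 0 then of_real t else 0)"

lemma const_poly_in_trig_polys: "const_poly t \<in> trig_polys n"
  by (simp add: const_poly_def trig_polys_def)

lemma node_val_const_poly [simp]: "node_val n N (const_poly t) j = t"
  by (simp add: node_val_def trig_eval_def const_poly_def if_distrib[of "\<lambda>x. x * _"] cong: if_cong)

lemma pos_polys_iff:
  "p \<in> pos_polys n N \<longleftrightarrow> p \<in> trig_polys n \<and> (\<forall>j\<in>nodes N. 0 < node_val n N p j)"
  by (simp add: pos_polys_def node_val_def)

lemma continuous_on_node_val [continuous_intros]:
  assumes "continuous_on S f"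
  shows "continuous_on S (\<lambda>x. node_val n N (f x) j)"
  unfolding node_val_def trig_eval_def
  by (intro continuous_intros continuous_on_product_then_coordinatewise[OF assms])

lemma closed_trig_polys: "closed (trig_polys n)"
  unfolding trig_polys_def
  by (intro closed_Collect_conj closed_Collect_all closed_Collect_imp closed_Collect_eq open_Collect_const
      continuous_intros continuous_on_product_coordinates)

text \<open>
  A polynomial that is nonnegative at the nodes is the limit, as \<open>t\<close> decreases to \<open>0\<close>, of the positive polynomials
  obtained by adding the constant \<open>t\<close>.
\<close>

lemma closure_pos_polys:
  "trig_polys n \<inter> closure (pos_polys n N) =
    {q \<in> trig_polys n. \<forall>j\<in>nodes N. 0 \<le> node_val n N q j}"
proof (intro subset_antisym subsetI)
  fix q assume q: "q \<in> trig_polys n \<inter> closure (pos_polys n N)"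
  have "closed {q. \<forall>j\<in>nodes N. 0 \<le> node_val n N q j}"
    unfolding Ball_def
    by (intro closed_Collect_all closed_Collect_imp open_Collect_const closed_Collect_le continuous_intros)
  moreover have "pos_polys n N \<subseteq> {q. \<forall>j\<in>nodes N. 0 \<le> node_val n N q j}"
    by (auto simp: pos_polys_iff less_imp_le)
  ultimately show "q \<in> {q \<in> trig_polys n. \<forall>j\<in>nodes N. 0 \<le> node_val n N q j}"
    using q closure_minimal by blast
next
  fix q assume q: "q \<in> {q \<in> trig_polys n. \<forall>j\<in>nodes N. 0 \<le> node_val n N q j}"
  define f where "f t = (\<lambda>k. q k + of_real t * const_poly 1 k)" for t
  have pos: "f ` {0<..} \<subseteq> pos_polys n N"
    using q by (auto simp: f_def pos_polys_iff node_val_add_scaled trig_polys_add_scaled const_poly_in_trig_polys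
        intro!: add_nonneg_pos)
  have "continuous_on UNIV f"
    unfolding f_def by (intro continuous_intros)
  then have "f ` closure {0<..} \<subseteq> closure (pos_polys n N)"
    by (intro image_closure_subset closed_closure order_trans[OF pos closure_subset])
       (auto intro: continuous_on_subset)
  moreover have "f 0 = q" by (simp add: f_def)
  ultimately show "q \<in> trig_polys n \<inter> closure (pos_polys n N)"
    using q by force
qed

text \<open>
  The pairing condition in terms of node values: the closed cone is described by nonnegativity at the nodes,
  and the pairing by Parseval.
\<close>

lemma dual_cone_iff:
  assumes nN: "n < N"
  shows "c \<in> dual_cone n N \<longleftrightarrow> c \<in> moment_space n \<and>
    (\<forall>r\<in>trig_polys n. (\<forall>j\<in>nodes N. 0 \<le> node_val n N r j) \<longrightarrow> r \<noteq> const_poly 0 \<longrightarrow>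
      0 < (\<Sum>j\<in>nodes N. node_val n N (herm_ext c) j * node_val n N r j))"
proof -
  have "(\<lambda>_. 0) = const_poly 0" by (simp add: const_poly_def fun_eq_iff)
  moreover have "0 < Re (pairing n c r) \<longleftrightarrow>
      0 < (\<Sum>j\<in>nodes N. node_val n N (herm_ext c) j * node_val n N r j)"
    if "c \<in> moment_space n" "r \<in> trig_polys n" for r
    unfolding pairing_eq_sum_node_val[OF that nN, symmetric]
    using nN by (simp add: zero_less_mult_iff)
  ultimately show ?thesis
    unfolding dual_cone_def closure_pos_polys by auto
qed

lemma moment_map_in_dual_cone:
  assumes p: "p \<in> pos_polys n N" and q: "q \<in> pos_polys n N" and nN: "n < N"
  shows "moment_map n N p q \<in> dual_cone n N"
proof -
  have T: "p \<in> trig_polys n" "q \<in> trig_polys n" using p q by (auto simp: pos_polys_iff)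
  have m: "moment_map n N p q \<in> moment_space n" by (rule moment_map_in_moment_space[OF T])
  show ?thesis
    unfolding dual_cone_iff[OF nN]
  proof (intro conjI ballI impI m)
    fix r assume r: "r \<in> trig_polys n" "\<forall>j\<in>nodes N. 0 \<le> node_val n N r j" "r \<noteq> const_poly 0"
    obtain i where i: "i \<in> nodes N" "node_val n N r i \<noteq> 0"
      using r(3) trig_poly_eqI[OF r(1) const_poly_in_trig_polys nN, of 0] by auto
    have "0 < (\<Sum>j\<in>nodes N. node_val n N p j / node_val n N q j * node_val n N r j)"
      using p q r i
      by (intro sum_pos2[OF _ i(1)] mult_pos_pos mult_nonneg_nonneg divide_pos_pos divide_nonneg_nonneg)
         (force simp: pos_polys_iff less_imp_le)+
    then show "0 < (\<Sum>j\<in>nodes N. node_val n N (herm_ext (moment_map n N p q)) j * node_val n N r j)"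
      using moment_map_eq_iff[OF m T nN] r(1) by simp
  qed
qed

text \<open>
  Coefficients are averages of node values by Fourier inversion, so bounds at the nodes confine the coefficients to
  a product of discs, which is compact by Tychonoff.
\<close>

lemma compact_node_val_box:
  assumes a: "\<And>j. 0 \<le> a j" and nN: "n < N"
  shows "compact {q \<in> trig_polys n. \<forall>j\<in>nodes N. a j \<le> node_val n N q j \<and> node_val n N q j \<le> b j}"
    (is "compact ?K")
proof -
  define B where "B = (\<Sum>j\<in>nodes N. b j)"
  have "compact (PiE UNIV (\<lambda>_. cball 0 B) :: (int \<Rightarrow> complex) set)"
    unfolding compactin_euclidean_iff[symmetric] euclidean_product_topology[symmetric] compactin_PiE
    by simp
  moreover have "?K \<subseteq> PiE UNIV (\<lambda>_. cball 0 B)"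
  proof
    fix q assume q: "q \<in> ?K"
    have nb: "\<bar>node_val n N q j\<bar> \<le> b j" if "j \<in> nodes N" for j
      using q that a[of j] by force
    then have B: "0 \<le> B" unfolding B_def by (intro sum_nonneg) force
    have "norm (q k) \<le> B" for k
    proof (cases "\<bar>k\<bar> \<le> int n")
      case True
      have "1 * norm (q k) \<le> norm (2 * of_nat N * q k)"
        unfolding norm_mult using nN by (intro mult_right_mono) auto
      also have "\<dots> \<le> (\<Sum>j\<in>nodes N. norm (root_pt N j powi k * of_real (node_val n N q j)))"
        using q True nN by (subst coeff_eq_sum_node_val) (auto intro: norm_sum)
      also have "\<dots> \<le> B"
        unfolding B_def by (intro sum_mono) (simp add: norm_mult norm_power_int nb)
      finally show ?thesis by simp
    qed (use q B in \<open>simp add: trig_polys_def\<close>)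
    then show "q \<in> PiE UNIV (\<lambda>_. cball 0 B)" by (auto simp: PiE_iff)
  qed
  moreover have "closed ?K"
  proof -
    have "closed {q. \<forall>j\<in>nodes N. a j \<le> node_val n N q j \<and> node_val n N q j \<le> b j}"
      unfolding Ball_def
      by (intro closed_Collect_conj closed_Collect_all closed_Collect_imp open_Collect_const closed_Collect_le
          continuous_intros)
    from closed_Int[OF closed_trig_polys this] show ?thesis by (simp add: Int_def)
  qed
  ultimately show ?thesis
    using compact_Int_closed[of "PiE UNIV (\<lambda>_. cball 0 B)" ?K] by (simp add: Int_absorb1)
qed

text \<open>
  The best constant is the minimum of the functional over the compact slice where the node values sum to \<open>1\<close>;
  it is positive because the slice avoids \<open>0\<close>. Homogeneity extends the bound to the whole cone.
\<close>

lemma dual_cone_coercive: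
  assumes c: "c \<in> dual_cone n N" and nN: "n < N"
  obtains e where "0 < e"
    "\<And>r. r \<in> trig_polys n \<Longrightarrow> (\<And>j. j \<in> nodes N \<Longrightarrow> 0 \<le> node_val n N r j) \<Longrightarrow>
      e * (\<Sum>j\<in>nodes N. node_val n N r j)
      \<le> (\<Sum>j\<in>nodes N. node_val n N (herm_ext c) j * node_val n N r j)"
proof -
  define L where "L r = (\<Sum>j\<in>nodes N. node_val n N (herm_ext c) j * node_val n N r j)" for r
  define s where "s r = (\<Sum>j\<in>nodes N. node_val n N r j)" for r
  define K where "K = {q \<in> trig_polys n. \<forall>j\<in>nodes N. 0 \<le> node_val n N q j \<and> node_val n N q j \<le> 1} \<inter> {q. s q = 1}"
  have "compact K"
    unfolding K_def s_def
    by (intro compact_Int_closed compact_node_val_box nN closed_Collect_eq continuous_intros) simp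
  moreover have "const_poly (1 / (2 * real N)) \<in> K"
    using nN by (auto simp: K_def s_def const_poly_in_trig_polys)
  moreover have "continuous_on K L"
    unfolding L_def by (intro continuous_intros)
  ultimately obtain q where q: "q \<in> K" and min: "\<And>r. r \<in> K \<Longrightarrow> L q \<le> L r"
    using continuous_attains_inf[of K L] by blast
  have "q \<noteq> const_poly 0" using q by (auto simp: K_def s_def)
  then have pos: "0 < L q" using c q by (auto simp: dual_cone_iff[OF nN] K_def L_def)
  have "L q * s r \<le> L r"
    if r: "r \<in> trig_polys n" "\<And>j. j \<in> nodes N \<Longrightarrow> 0 \<le> node_val n N r j" for r
  proof (cases "s r = 0")
    case True
    then have "\<forall>j\<in>nodes N. node_val n N r j = 0"
      unfolding s_def by (subst (asm) sum_nonneg_eq_0_iff) (use r in auto)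
    then show ?thesis using True by (simp add: L_def)
  next
    case False
    have s: "0 < s r" using False sum_nonneg[of "nodes N" "node_val n N r"] r(2) by (simp add: s_def)
    define r' where "r' = (\<lambda>k. const_poly 0 k + of_real (1 / s r) * r k)"
    have v: "node_val n N r' j = node_val n N r j / s r" for j
      unfolding r'_def node_val_add_scaled by simp
    have le: "node_val n N r j \<le> s r" if "j \<in> nodes N" for j
      unfolding s_def by (rule member_le_sum[OF that]) (use r in auto)
    have "s r' = 1" unfolding s_def v using s by (simp add: s_def flip: sum_divide_distrib)
    moreover have "r' \<in> trig_polys n" unfolding r'_def by (intro trig_polys_add_scaled const_poly_in_trig_polys r)
    ultimately have "r' \<in> K" using r le s by (simp add: K_def v)
    then have "L q \<le> L r'" by (rule min)
    also have "L r' = L r / s r" by (simp add: L_def v flip: sum_divide_distrib)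
    finally show ?thesis using s by (simp add: field_simps)
  qed
  with pos show thesis by (intro that[of "L q"]) (simp_all add: L_def s_def)
qed

section \<open>Existence by minimisation of the logarithmic barrier functional\<close>

text \<open>
  This is \<open>ln x \<le> x - 1\<close> at \<open>x = t * e / (2 * p)\<close>; the scaling is chosen so that only half of the linear term is
  spent on the logarithm. The remaining half bounds \<open>t\<close> from above on sublevel sets.
\<close>

lemma linear_minus_log_lower_bound:
  fixes e p t :: real
  assumes "0 < e" "0 < p" "0 < t"
  shows "e * t / 2 + (p + p * ln (e / (2 * p))) \<le> e * t - p * ln t"
proof -
  have "ln (t * (e / (2 * p))) \<le> t * (e / (2 * p)) - 1"
    using assms by (intro ln_le_minus_one) simp
  then have "p * (ln t + ln (e / (2 * p))) \<le> p * (t * (e / (2 * p)) - 1)"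
    using assms by (subst (asm) ln_mult) auto
  also have "\<dots> = e * t / 2 - p" using assms by (simp add: field_simps)
  finally show ?thesis by (simp add: distrib_left)
qed

text \<open>
  The minimiser of \<open>\<Sum>j. c\<^sub>j * Q\<^sub>j - P\<^sub>j * ln Q\<^sub>j\<close> over the open cone solves the moment equation: the logarithm keeps it
  off the boundary and the coercivity of \<open>c\<close> keeps it bounded, so every direction may be used to take the
  derivative.
\<close>

lemma moment_map_surj:
  assumes c: "c \<in> dual_cone n N" and p: "p \<in> pos_polys n N" and nN: "n < N"
  obtains q where "q \<in> pos_polys n N" "moment_map n N p q = c"
proof -
  let ?J = "nodes N"
  let ?v = "node_val n N"
  define h where "h = herm_ext c"
  have pp: "0 < ?v p j" if "j \<in> ?J" for j using p that by (simp add: pos_polys_iff)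
  obtain e where e: "0 < e" "\<And>r. r \<in> trig_polys n \<Longrightarrow> (\<And>j. j \<in> ?J \<Longrightarrow> 0 \<le> ?v r j) \<Longrightarrow>
      e * (\<Sum>j\<in>?J. ?v r j) \<le> (\<Sum>j\<in>?J. ?v h j * ?v r j)"
    using dual_cone_coercive[OF c nN] unfolding h_def by metis
  define f where "f q = (\<Sum>j\<in>?J. ?v h j * ?v q j - ?v p j * ln (?v q j))" for q
  define u where "u = const_poly 1"
  have u: "u \<in> pos_polys n N" by (simp add: u_def pos_polys_iff const_poly_in_trig_polys)
  \<comment> \<open>\<open>m j\<close> is a lower bound of the summand at \<open>j\<close>. On the sublevel set of \<open>f u\<close> no summand can exceed \<open>M\<close>,
    since the others cannot compensate by more than their lower bounds; \<open>a\<close> and \<open>b\<close> are the resulting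
    bounds for the node values.\<close>
  define m where "m j = ?v p j + ?v p j * ln (e / (2 * ?v p j))" for j
  define M where "M = f u + (\<Sum>j\<in>?J. \<bar>m j\<bar>)"
  define a where "a j = exp (- M / ?v p j)" for j
  define b where "b j = 2 * (M + \<bar>m j\<bar>) / e" for j
  define K where "K = {q \<in> trig_polys n. \<forall>j\<in>?J. a j \<le> ?v q j \<and> ?v q j \<le> b j}"
  have K_pos: "K \<subseteq> pos_polys n N"
  proof
    fix q assume "q \<in> K"
    then show "q \<in> pos_polys n N"
      by (auto simp: K_def a_def pos_polys_iff intro: less_le_trans[OF exp_gt_zero])
  qed
  have sublevel: "q \<in> K" if q: "q \<in> pos_polys n N" and le: "f q \<le> f u" for q
  proof -
    have vq: "0 < ?v q j" if "j \<in> ?J" for j using q that by (simp add: pos_polys_iff)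
    have low: "e * ?v q j / 2 + m j \<le> e * ?v q j - ?v p j * ln (?v q j)" if "j \<in> ?J" for j
      unfolding m_def by (intro linear_minus_log_lower_bound e pp vq that)
    have "e * (\<Sum>j\<in>?J. ?v q j) \<le> (\<Sum>j\<in>?J. ?v h j * ?v q j)"
      using q vq by (intro e) (auto simp: pos_polys_iff less_imp_le)
    then have tot: "(\<Sum>j\<in>?J. e * ?v q j - ?v p j * ln (?v q j)) \<le> f u"
      using le by (simp add: f_def sum_subtractf sum_distrib_left)
    have up: "e * ?v q i - ?v p i * ln (?v q i) \<le> M" if i: "i \<in> ?J" for i
    proof -
      have "e * ?v q i - ?v p i * ln (?v q i) + \<bar>m i\<bar> \<le> (\<Sum>j\<in>?J. (e * ?v q j - ?v p j * ln (?v q j)) + \<bar>m j\<bar>)"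
      proof (rule member_le_sum[OF i])
        fix j assume "j \<in> ?J - {i}"
        then have j: "j \<in> ?J" by simp
        have "0 \<le> e * ?v q j" using e(1) vq[OF j] by simp
        with low[OF j] show "0 \<le> (e * ?v q j - ?v p j * ln (?v q j)) + \<bar>m j\<bar>" by linarith
      qed simp
      also have "\<dots> \<le> M" using tot by (simp add: sum.distrib M_def)
      finally show ?thesis by linarith
    qed
    have "a j \<le> ?v q j \<and> ?v q j \<le> b j" if j: "j \<in> ?J" for j
    proof
      have "0 \<le> e * ?v q j" using e(1) vq[OF j] by simp
      then have "- M / ?v p j \<le> ln (?v q j)"
        using up[OF j] pp[OF j] by (simp add: field_simps)
      then show "a j \<le> ?v q j" unfolding a_def using vq[OF j] by (simp add: ln_ge_iff)
      have "e * ?v q j \<le> 2 * (M + \<bar>m j\<bar>)" using low[OF j] up[OF j] abs_ge_minus_self[of "m j"] by (simp add: distrib_left)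
      then show "?v q j \<le> b j" using e(1) by (simp add: b_def field_simps)
    qed
    then show ?thesis using q by (simp add: K_def pos_polys_iff)
  qed
  have "compact K"
    unfolding K_def by (rule compact_node_val_box[OF _ nN]) (simp add: a_def)
  moreover have "u \<in> K" using sublevel[OF u] by simp
  moreover have "continuous_on K f"
    unfolding f_def using K_pos by (intro continuous_intros) (force simp: pos_polys_iff)
  ultimately obtain q where q: "q \<in> K" and minK: "\<And>r. r \<in> K \<Longrightarrow> f q \<le> f r"
    using continuous_attains_inf[of K f] by blast
  have qP: "q \<in> pos_polys n N" using q K_pos by blast
  have min: "f q \<le> f r" if "r \<in> pos_polys n N" for r
    using minK[OF \<open>u \<in> K\<close>] minK[of r] sublevel[OF that] by linarith
  have qT: "q \<in> trig_polys n" and vq: "\<And>j. j \<in> ?J \<Longrightarrow> 0 < ?v q j"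
    using qP by (auto simp: pos_polys_iff)
  \<comment> \<open>Stationarity in the direction \<open>r\<close>; near \<open>q\<close> the line in this direction stays in the open cone.\<close>
  have "(\<Sum>j\<in>?J. ?v h j * ?v r j) = (\<Sum>j\<in>?J. ?v p j / ?v q j * ?v r j)" if r: "r \<in> trig_polys n" for r
  proof -
    define g where "g t = (\<Sum>j\<in>?J. ?v h j * (?v q j + t * ?v r j) - ?v p j * ln (?v q j + t * ?v r j))" for t
    have g: "g t = f (\<lambda>k. q k + of_real t * r k)" for t
      by (simp add: g_def f_def node_val_add_scaled)
    have "(g has_real_derivative (\<Sum>j\<in>?J. ?v h j * ?v r j - ?v p j * (?v r j / ?v q j))) (at 0)"
      unfolding g_def by (auto intro!: derivative_eq_intros vq sum.cong simp: vq)
    moreover have "\<forall>\<^sub>F t in nhds 0. \<forall>j\<in>?J. 0 < ?v q j + t * ?v r j"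
    proof (intro eventually_ball_finite ballI)
      fix j assume j: "j \<in> ?J"
      have "((\<lambda>t. ?v q j + t * ?v r j) \<longlongrightarrow> ?v q j + 0 * ?v r j) (nhds 0)"
        by (intro tendsto_intros filterlim_ident)
      then show "\<forall>\<^sub>F t in nhds 0. 0 < ?v q j + t * ?v r j"
        by (rule order_tendstoD) (use vq[OF j] in simp)
    qed simp
    then obtain d where "0 < d" and d: "\<And>t j. dist t 0 < d \<Longrightarrow> j \<in> ?J \<Longrightarrow> 0 < ?v q j + t * ?v r j"
      unfolding eventually_nhds_metric by blast
    moreover have "\<forall>t. \<bar>0 - t\<bar> < d \<longrightarrow> g 0 \<le> g t"
    proof (intro allI impI)
      fix t assume "\<bar>0 - t\<bar> < d"
      then have "(\<lambda>k. q k + of_real t * r k) \<in> pos_polys n N"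
        using d[of t] by (simp add: pos_polys_iff node_val_add_scaled trig_polys_add_scaled qT r)
      from min[OF this] show "g 0 \<le> g t" by (simp add: g)
    qed
    ultimately have "(\<Sum>j\<in>?J. ?v h j * ?v r j - ?v p j * (?v r j / ?v q j)) = 0"
      by (intro DERIV_local_min)
    then show ?thesis by (simp add: sum_subtractf)
  qed
  then have "moment_map n N p q = c"
    using moment_map_eq_iff[of c n p q N] c p qT nN by (simp add: h_def dual_cone_iff pos_polys_iff)
  with qP show thesis by (rule that)
qed

section \<open>Continuity and injectivity of the solution maps\<close>

text \<open>
  On trigonometric polynomials, convergence at the nodes is convergence in the coefficient space, by Fourier
  inversion.
\<close>

lemma tendsto_coeff:
  assumes nN: "n < N" and p: "p \<in> trig_polys n" and p': "\<forall>\<^sub>F x in F. p' x \<in> trig_polys n"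
    and lim: "\<And>j. j \<in> nodes N \<Longrightarrow> ((\<lambda>x. node_val n N (p' x) j) \<longlongrightarrow> node_val n N p j) F"
  shows "((\<lambda>x. p' x k) \<longlongrightarrow> p k) F"
proof (cases "\<bar>k\<bar> \<le> int n")
  case True
  define s where "s v = (\<Sum>j\<in>nodes N. root_pt N j powi k * complex_of_real (v j)) / (2 * of_nat N)" for v
  have s: "r k = s (node_val n N r)" if "r \<in> trig_polys n" for r
    using coeff_eq_sum_node_val[OF that True nN] nN by (simp add: s_def field_simps)
  have "((\<lambda>x. s (node_val n N (p' x))) \<longlongrightarrow> s (node_val n N p)) F"
    unfolding s_def using nN by (intro tendsto_intros lim) auto
  then have "((\<lambda>x. s (node_val n N (p' x))) \<longlongrightarrow> p k) F"
    by (simp only: s[OF p])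
  moreover have "\<forall>\<^sub>F x in F. s (node_val n N (p' x)) = p' x k"
    using p' by eventually_elim (rule s[symmetric])
  ultimately show ?thesis
    by (rule Lim_transform_eventually)
next
  case False
  have "\<forall>\<^sub>F x in F. p k = p' x k"
    using p' by eventually_elim (use p False in \<open>simp add: trig_polys_def\<close>)
  then show ?thesis by (rule Lim_transform_eventually[OF tendsto_const])
qed

lemma sum_node_val_moment_map:
  assumes nN: "n < N" and T: "p \<in> trig_polys n" "q \<in> trig_polys n" "r \<in> trig_polys n"
  shows "(\<Sum>j\<in>nodes N. node_val n N (herm_ext (moment_map n N p q)) j * node_val n N r j)
      = (\<Sum>j\<in>nodes N. node_val n N p j / node_val n N q j * node_val n N r j)"
  using moment_map_eq_iff[OF moment_map_in_moment_space[OF T(1,2)] T(1,2) nN] T(3) by blast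

text \<open>
  \<open>Q\<close> depends continuously on \<open>P\<close> and \<open>c\<close> jointly. Filters allow the same lemma to serve for
  varying \<open>c\<close>, for varying \<open>P\<close>, and, with constant families, for uniqueness.
\<close>

lemma tendsto_denominator:
  assumes nN: "n < N" and p: "p \<in> pos_polys n N" and q: "q \<in> pos_polys n N"
    and ev: "\<forall>\<^sub>F x in F. p' x \<in> pos_polys n N \<and> q' x \<in> pos_polys n N"
    and lim_p: "\<And>j. ((\<lambda>x. node_val n N (p' x) j) \<longlongrightarrow> node_val n N p j) F"
    and lim_c: "\<And>j. ((\<lambda>x. node_val n N (herm_ext (moment_map n N (p' x) (q' x))) j)
                 \<longlongrightarrow> node_val n N (herm_ext (moment_map n N p q)) j) F"
  shows "((\<lambda>x. q' x k) \<longlongrightarrow> q k) F"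
proof (rule tendsto_coeff[OF nN])
  show "q \<in> trig_polys n" "\<forall>\<^sub>F x in F. q' x \<in> trig_polys n"
    using q ev by (auto simp: pos_polys_iff elim: eventually_mono)
  fix i assume i: "i \<in> nodes N"
  show "((\<lambda>x. node_val n N (q' x) i) \<longlongrightarrow> node_val n N q i) F"
  proof (rule tendsto_denominator_of_moment_relations[OF finite_atLeastAtMost_int i _ _ _ lim_p lim_c])
    show "\<forall>\<^sub>F x in F. \<forall>j\<in>nodes N. 0 < node_val n N (p' x) j \<and> 0 < node_val n N (q' x) j"
      using ev by eventually_elim (simp add: pos_polys_iff)
    show "\<forall>\<^sub>F x in F. \<forall>r\<in>{node_val n N q, node_val n N (q' x)}.
        (\<Sum>j\<in>nodes N. node_val n N (herm_ext (moment_map n N p q)) j * r j)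
          = (\<Sum>j\<in>nodes N. node_val n N p j / node_val n N q j * r j) \<and>
        (\<Sum>j\<in>nodes N. node_val n N (herm_ext (moment_map n N (p' x) (q' x))) j * r j)
          = (\<Sum>j\<in>nodes N. node_val n N (p' x) j / node_val n N (q' x) j * r j)"
      using ev
    proof eventually_elim
      case (elim x)
      then have "p \<in> trig_polys n" "q \<in> trig_polys n" "p' x \<in> trig_polys n" "q' x \<in> trig_polys n"
        using p q by (simp_all add: pos_polys_iff)
      then show ?case by (simp only: ball_simps sum_node_val_moment_map[OF nN] simp_thms)
    qed
  qed (use p q in \<open>simp_all add: pos_polys_iff\<close>)
qed

text \<open>
  \<open>P\<close> depends continuously on \<open>Q\<close> while the moments stay fixed: the difference of the two numerators is a
  legitimate test polynomial for both moment equations.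
\<close>

lemma tendsto_numerator:
  assumes nN: "n < N" and p: "p \<in> pos_polys n N" and q: "q \<in> pos_polys n N"
    and ev: "\<forall>\<^sub>F x in F. p' x \<in> pos_polys n N \<and> q' x \<in> pos_polys n N \<and>
      moment_map n N (p' x) (q' x) = moment_map n N p q"
    and lim_q: "\<And>j. ((\<lambda>x. node_val n N (q' x) j) \<longlongrightarrow> node_val n N q j) F"
  shows "((\<lambda>x. p' x k) \<longlongrightarrow> p k) F"
proof (rule tendsto_coeff[OF nN])
  show T: "p \<in> trig_polys n" "\<forall>\<^sub>F x in F. p' x \<in> trig_polys n"
    using p ev by (auto simp: pos_polys_iff elim: eventually_mono)
  fix i assume i: "i \<in> nodes N"
  show "((\<lambda>x. node_val n N (p' x) i) \<longlongrightarrow> node_val n N p i) F"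
  proof (rule tendsto_numerator_of_moment_relations[OF finite_atLeastAtMost_int i _ _ lim_q])
    show "\<forall>\<^sub>F x in F. \<forall>j\<in>nodes N. 0 < node_val n N (q' x) j"
      using ev by eventually_elim (simp add: pos_polys_iff)
    show "\<forall>\<^sub>F x in F.
        (\<Sum>j\<in>nodes N. node_val n N (p' x) j / node_val n N (q' x) j * (node_val n N (p' x) j - node_val n N p j))
        = (\<Sum>j\<in>nodes N. node_val n N p j / node_val n N q j * (node_val n N (p' x) j - node_val n N p j))"
      using ev
    proof eventually_elim
      case (elim x)
      define d where "d = (\<lambda>k. p' x k + of_real (- 1) * p k)"
      have S: "p' x \<in> trig_polys n" "q' x \<in> trig_polys n" "q \<in> trig_polys n"
        using elim q by (auto simp: pos_polys_iff)
      have d: "d \<in> trig_polys n"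
        unfolding d_def by (intro trig_polys_add_scaled S T(1))
      have "node_val n N d j = node_val n N (p' x) j - node_val n N p j" for j
        unfolding d_def node_val_add_scaled by simp
      moreover have "moment_map n N (p' x) (q' x) = moment_map n N p q" using elim by blast
      ultimately show ?case
        using sum_node_val_moment_map[OF nN S(1,2) d] sum_node_val_moment_map[OF nN T(1) S(3) d] by simp
    qed
  qed (use q in \<open>simp add: pos_polys_iff\<close>)
qed

lemma moment_map_inj_denominator:
  assumes nN: "n < N" and "p \<in> pos_polys n N" "q \<in> pos_polys n N" "q' \<in> pos_polys n N"
    and "moment_map n N p q' = moment_map n N p q"
  shows "q' = q"
proof
  fix k
  have "((\<lambda>x::nat. q' k) \<longlongrightarrow> q k) sequentially"
    by (rule tendsto_denominator[OF nN assms(2,3), where p' = "\<lambda>_. p"]) (use assms in simp_all)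
  then show "q' k = q k" by (simp add: tendsto_const_iff)
qed

lemma moment_map_inj_numerator:
  assumes nN: "n < N" and "p \<in> pos_polys n N" "p' \<in> pos_polys n N" "q \<in> pos_polys n N"
    and "moment_map n N p' q = moment_map n N p q"
  shows "p' = p"
proof
  fix k
  have "((\<lambda>x::nat. p' k) \<longlongrightarrow> p k) sequentially"
    by (rule tendsto_numerator[OF nN assms(2,4), where q' = "\<lambda>_. q"]) (use assms in simp_all)
  then show "p' k = p k" by (simp add: tendsto_const_iff)
qed

lemma continuous_on_herm_ext: "continuous_on S herm_ext"
proof (rule continuous_on_coordinatewise_then_product)
  fix k
  have "continuous_on S (\<lambda>c :: nat \<Rightarrow> complex. c i)" for i
    by (rule continuous_on_subset[OF continuous_on_product_coordinates]) simp
  then show "continuous_on S (\<lambda>c. herm_ext c k)"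
    by (cases "0 \<le> k") (simp_all add: herm_ext_def continuous_on_cnj)
qed

lemma continuous_on_moment_map: "continuous_on (pos_polys n N) (moment_map n N p)"
proof (rule continuous_on_coordinatewise_then_product)
  fix k
  define S where "S q = (\<Sum>j\<in>nodes N.
      root_pt N j ^ k * (trig_eval n p (root_pt N j) / trig_eval n q (root_pt N j)))" for q
  have nz: "trig_eval n q (root_pt N j) \<noteq> 0" if "q \<in> pos_polys n N" "j \<in> nodes N" for q j
    using that by (force simp: pos_polys_def)
  have "continuous_on (pos_polys n N) (\<lambda>q. trig_eval n q z)" for z
    unfolding trig_eval_def by (intro continuous_intros continuous_on_product_then_coordinatewise)
  then have S: "continuous_on (pos_polys n N) S"
    unfolding S_def using nz
    by (intro continuous_on_sum continuous_on_mult[OF continuous_on_const]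
        continuous_on_divide[OF continuous_on_const]) blast+
  show "continuous_on (pos_polys n N) (\<lambda>q. moment_map n N p q k)"
  proof (cases "k \<le> n")
    case True
    then have "(\<lambda>q. moment_map n N p q k) = (\<lambda>q. 1 / (2 * of_nat N) * S q)"
      by (simp only: moment_map_def S_def if_True)
    then show ?thesis
      by (simp only: continuous_on_mult[OF continuous_on_const S])
  qed (simp add: moment_map_def)
qed

lemma continuous_on_coeffI:
  fixes f :: "'a::topological_space \<Rightarrow> int \<Rightarrow> complex"
  assumes "\<And>k x. x \<in> S \<Longrightarrow> ((\<lambda>y. f y k) \<longlongrightarrow> f x k) (at x within S)"
  shows "continuous_on S f"
  by (rule continuous_on_coordinatewise_then_product) (simp add: continuous_on_def assms)

lemma tendsto_node_val_within:
  assumes "continuous_on S f" "x \<in> S"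
  shows "((\<lambda>y. node_val n N (f y) j) \<longlongrightarrow> node_val n N (f x) j) (at x within S)"
  using continuous_on_node_val[OF assms(1)] assms(2) by (simp add: continuous_on_def)

section \<open>The two homeomorphisms\<close>

lemma moment_map_homeomorphism:
  assumes nN: "n < N" and p: "p \<in> pos_polys n N"
  shows "\<exists>g. homeomorphism (pos_polys n N) (dual_cone n N) (moment_map n N p) g"
proof -
  define g where "g c = (SOME q. q \<in> pos_polys n N \<and> moment_map n N p q = c)" for c
  have g: "g c \<in> pos_polys n N" "moment_map n N p (g c) = c" if "c \<in> dual_cone n N" for c
    using someI_ex[of "\<lambda>q. q \<in> pos_polys n N \<and> moment_map n N p q = c"] moment_map_surj[OF that p nN]
    unfolding g_def by blast+
  have hom: "homeomorphism (pos_polys n N) (dual_cone n N) (moment_map n N p) g"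
  proof
    show "continuous_on (pos_polys n N) (moment_map n N p)" by (rule continuous_on_moment_map)
    show "moment_map n N p ` pos_polys n N \<subseteq> dual_cone n N" using moment_map_in_dual_cone[OF p _ nN] by blast
    show "g ` dual_cone n N \<subseteq> pos_polys n N" using g(1) by blast
    show "g (moment_map n N p q) = q" if "q \<in> pos_polys n N" for q
      using moment_map_inj_denominator[OF nN p that] g moment_map_in_dual_cone[OF p that nN] by blast
    show "moment_map n N p (g c) = c" if "c \<in> dual_cone n N" for c using g(2) that .
    show "continuous_on (dual_cone n N) g"
    proof (rule continuous_on_coeffI)
      fix k c assume c: "c \<in> dual_cone n N"
      have ev: "\<forall>\<^sub>F x in at c within dual_cone n N. x \<in> dual_cone n N"
        by (simp add: eventually_at_filter)
      show "((\<lambda>c. g c k) \<longlongrightarrow> g c k) (at c within dual_cone n N)"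
      proof (rule tendsto_denominator[OF nN p g(1)[OF c], where p' = "\<lambda>_. p"])
        show "\<forall>\<^sub>F x in at c within dual_cone n N. p \<in> pos_polys n N \<and> g x \<in> pos_polys n N"
          using ev by eventually_elim (simp add: p g)
        fix j
        show "((\<lambda>x. node_val n N (herm_ext (moment_map n N p (g x))) j) \<longlongrightarrow>
            node_val n N (herm_ext (moment_map n N p (g c))) j) (at c within dual_cone n N)"
          unfolding g(2)[OF c]
          by (rule Lim_transform_eventually[OF tendsto_node_val_within[OF continuous_on_herm_ext c]])
             (use ev in eventually_elim, simp add: g c)
      qed (rule tendsto_const)
    qed
  qed
  show ?thesis by (rule exI[where x = g], rule hom)
qed

lemma solution_map_homeomorphism:
  assumes nN: "n < N" and c: "c \<in> dual_cone n N"
  shows "\<exists>g. homeomorphism (pos_polys n N) (solution_set n N c) (solution_map n N c) g"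
proof -
  let ?G = "solution_map n N c"
  have G: "?G p \<in> pos_polys n N" "moment_map n N p (?G p) = c" if p: "p \<in> pos_polys n N" for p
  proof -
    obtain q where q: "q \<in> pos_polys n N" "moment_map n N p q = c" using moment_map_surj[OF c p nN] .
    have "?G p = q"
      unfolding solution_map_def
    proof (rule the_equality)
      show "q' = q" if "q' \<in> pos_polys n N \<and> moment_map n N p q' = c" for q'
        by (rule moment_map_inj_denominator[OF nN p q(1)]) (use that q(2) in simp_all)
    qed (use q in blast)
    with q show "?G p \<in> pos_polys n N" "moment_map n N p (?G p) = c" by auto
  qed
  define g where "g q = (SOME p. p \<in> pos_polys n N \<and> moment_map n N p q = c)" for q
  have g: "g q \<in> pos_polys n N" "moment_map n N (g q) q = c" if "q \<in> solution_set n N c" for q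
    using someI_ex[of "\<lambda>p. p \<in> pos_polys n N \<and> moment_map n N p q = c"] that
    unfolding g_def solution_set_def by blast+
  have S: "q \<in> pos_polys n N" if "q \<in> solution_set n N c" for q using that by (simp add: solution_set_def)
  have GS: "?G p \<in> solution_set n N c" if "p \<in> pos_polys n N" for p
    using G[OF that] that by (auto simp: solution_set_def)
  have hom: "homeomorphism (pos_polys n N) (solution_set n N c) ?G g"
  proof
    show "?G ` pos_polys n N \<subseteq> solution_set n N c" using GS by blast
    show "g ` solution_set n N c \<subseteq> pos_polys n N" using g(1) by blast
    show "g (?G p) = p" if "p \<in> pos_polys n N" for p
      by (rule moment_map_inj_numerator[OF nN that g(1)[OF GS[OF that]] G(1)[OF that]])
         (simp add: G g GS that)
    show "?G (g q) = q" if "q \<in> solution_set n N c" for q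
      by (rule moment_map_inj_denominator[OF nN g(1)[OF that] S[OF that] G(1)[OF g(1)[OF that]]])
         (simp add: G g that)
    show "continuous_on (pos_polys n N) ?G"
    proof (rule continuous_on_coeffI)
      fix k p assume p: "p \<in> pos_polys n N"
      have ev: "\<forall>\<^sub>F x in at p within pos_polys n N. x \<in> pos_polys n N"
        by (simp add: eventually_at_filter)
      show "((\<lambda>p. ?G p k) \<longlongrightarrow> ?G p k) (at p within pos_polys n N)"
      proof (rule tendsto_denominator[OF nN p G(1)[OF p], where p' = "\<lambda>p. p"])
        show "\<forall>\<^sub>F x in at p within pos_polys n N. x \<in> pos_polys n N \<and> ?G x \<in> pos_polys n N"
          using ev by eventually_elim (simp add: G)
        fix j
        show "((\<lambda>x. node_val n N x j) \<longlongrightarrow> node_val n N p j) (at p within pos_polys n N)"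
          by (rule tendsto_node_val_within[OF continuous_on_id p])
        show "((\<lambda>x. node_val n N (herm_ext (moment_map n N x (?G x))) j) \<longlongrightarrow>
            node_val n N (herm_ext (moment_map n N p (?G p))) j) (at p within pos_polys n N)"
          unfolding G(2)[OF p]
          by (rule Lim_transform_eventually[OF tendsto_const]) (use ev in eventually_elim, simp add: G)
      qed
    qed
    show "continuous_on (solution_set n N c) g"
    proof (rule continuous_on_coeffI)
      fix k q assume q: "q \<in> solution_set n N c"
      have ev: "\<forall>\<^sub>F x in at q within solution_set n N c. x \<in> solution_set n N c"
        by (simp add: eventually_at_filter)
      show "((\<lambda>q. g q k) \<longlongrightarrow> g q k) (at q within solution_set n N c)"
      proof (rule tendsto_numerator[OF nN g(1)[OF q] S[OF q], where q' = "\<lambda>q. q"])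
        show "\<forall>\<^sub>F x in at q within solution_set n N c. g x \<in> pos_polys n N \<and> x \<in> pos_polys n N \<and>
            moment_map n N (g x) x = moment_map n N (g q) q"
          using ev by eventually_elim (simp add: g S q)
        show "((\<lambda>x. node_val n N x j) \<longlongrightarrow> node_val n N q j) (at q within solution_set n N c)" for j
          by (rule tendsto_node_val_within[OF continuous_on_id q])
      qed
    qed
  qed
  show ?thesis by (rule exI[where x = g], rule hom)
qed

theorem theorem3:
  fixes n N :: nat
  assumes "0 < n" and "n < N"
  shows "(\<forall>p \<in> pos_polys n N.
            \<exists>g. homeomorphism (pos_polys n N) (dual_cone n N) (moment_map n N p) g) \<and>
         (\<forall>c \<in> dual_cone n N.
            \<exists>g. homeomorphism (pos_polys n N) (solution_set n N c) (solution_map n N c) g)"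
proof (intro conjI ballI)
  fix p assume p: "p \<in> pos_polys n N"
  show "\<exists>g. homeomorphism (pos_polys n N) (dual_cone n N) (moment_map n N p) g"
    by (rule moment_map_homeomorphism[OF assms(2) p])
next
  fix c assume c: "c \<in> dual_cone n N"
  show "\<exists>g. homeomorphism (pos_polys n N) (solution_set n N c) (solution_map n N c) g"
    by (rule solution_map_homeomorphism[OF assms(2) c])
qed

end
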